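(* The $n$-state polynomials $\{Z_{W_n}(G)\}_{n=1}^{\infty}$ are complete invariants for graphs; that is, for any two finite undirected graphs $G$ and $H$, one has $Z_{W_n}(G)=Z_{W_n}(H)$ for all integers $n\ge 1$ if and only if $G$ and $H$ are isomorphic.
   Context: Graphs are finite and undirected; multiple edges and loops are allowed, and isolated vertices are allowed. $V(G)$ is the vertex set of $G$ and $E(G)$ its (multi)set of edges; an edge with endpoints $u,v$ is written $uv$. Isomorphism of graphs means a bijection of vertex sets preserving the number of edges between each pair of (not necessarily distinct) vertices. For an integer $n\ge 1$, let $X=\{1,2,\ldots,n\}$ and let $W_n=(x_{ij})_{i,j\in X}$ be the symmetric $n\times n$ matrix whose entries are variables, i.e. $x_{ij}=x_{ji}$ and the $n(n+1)/2$ variables $x_{ij}$ with $1\le i\le j\le n$ are independent (algebraically independent indeterminates over $\mathbb{Z}$). Write $W_n(i,j)=x_{ij}$. A state function is any map $\sigma:V(G)\to X$. The $n$-state polynomial of $G$ is $$Z_{W_n}(G)=\sum_{\sigma:V(G)\to X}\ \prod_{uv\in E(G)}W_n(\sigma(u),\sigma(v)),$$ where $\sigma$ runs over all state functions, the product is over all edges counted with multiplicity, and an empty product equals $1$. *)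

theory Defs
  imports "HOL-Library.Multiset" "HOL-Library.FuncSet" "HOL-Library.Uprod" "HOL-Library.Poly_Mapping"
begin

record 'a multigraph =
  verts :: "'a set"
  edges :: "'a uprod multiset"

text \<open>An edge is an unordered pair of endpoints; the pair \<open>Upair u u\<close> is a loop at \<open>u\<close>, and
  multiple edges are repeated elements of the multiset.\<close>

definition finite_graph :: "'a multigraph \<Rightarrow> bool" where
  "finite_graph G \<longleftrightarrow> finite (verts G) \<and> (\<forall>e \<in># edges G. set_uprod e \<subseteq> verts G)"

definition graph_isomorphic :: "'a multigraph \<Rightarrow> 'b multigraph \<Rightarrow> bool" where
  "graph_isomorphic G H \<longleftrightarrow>
    (\<exists>f. bij_betw f (verts G) (verts H) \<and>
      (\<forall>u \<in> verts G. \<forall>v \<in> verts G.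
        count (edges G) (Upair u v) = count (edges H) (Upair (f u) (f v))))"

text \<open>Polynomials with integer coefficients in one indeterminate per unordered pair of natural
  numbers: an element maps each monomial (a finitely supported exponent function) to its
  coefficient. The polynomial rings in the variables \<open>x\<^sub>i\<^sub>j\<close> with \<open>1 \<le> i \<le> j \<le> n\<close>
  are, for all \<open>n\<close>, subrings of this one.\<close>

type_synonym state_poly = "(nat uprod \<Rightarrow>\<^sub>0 nat) \<Rightarrow>\<^sub>0 int"

text \<open>The entry \<open>W\<^sub>n(i,j) = x\<^sub>i\<^sub>j\<close> of the generic symmetric matrix does not depend on \<open>n\<close>;
  the size \<open>n\<close> enters through the range of the state functions.\<close>

definition W :: "nat \<Rightarrow> nat \<Rightarrow> state_poly" where
  "W i j = Poly_Mapping.single (Poly_Mapping.single (Upair i j) 1) 1"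

lemma W_sym: "W i j = W j i"
proof -
  have "Upair i j = Upair j i" by simp
  then show ?thesis unfolding W_def by (rule arg_cong)
qed

lift_definition W_commute :: "(nat, state_poly) commute" is W
  by (rule W_sym)

definition edge_weight :: "('a \<Rightarrow> nat) \<Rightarrow> 'a uprod \<Rightarrow> state_poly" where
  "edge_weight \<sigma> e = case_uprod W_commute (map_uprod \<sigma> e)"

lemma edge_weight_Upair [simp]: "edge_weight \<sigma> (Upair u v) = W (\<sigma> u) (\<sigma> v)"
  by (simp add: edge_weight_def W_commute.rep_eq)

text \<open>State functions are extensional on the vertex set, so that each map from \<open>verts G\<close> to
  \<open>{1..n}\<close> is counted exactly once.\<close>

definition Z :: "nat \<Rightarrow> 'a multigraph \<Rightarrow> state_poly" where
  "Z n G = (\<Sum>\<sigma> \<in> verts G \<rightarrow>\<^sub>E {1..n}. \<Prod>e \<in># edges G. edge_weight \<sigma> e)"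

end

(* Under a state function, the product of the edge weights is a monomial which records exactly the
   image of the edge multiset, so the coefficients of the n-state polynomial count the state
   functions with a given image. The sum of the coefficients, n to the number of vertices,
   determines the number of vertices. An injective state function of G is available for large n;
   a state function of H with the same monomial gives a map of vertices taking the edges of H
   to those of G, hence the non-isolated vertices of H onto those of G. By symmetry the numbers of
   non-isolated vertices agree, so this map is injective on them, and it extends to an
   isomorphism by any bijection of the isolated vertices. *)
theory Submission
  imports Defs
begin

text \<open>The codomain is arbitrary, so that one notion serves both state functions, with values
  in \<open>nat\<close>, and vertex maps between two graphs.\<close>

definition state_image :: "'a multigraph \<Rightarrow> ('a \<Rightarrow> 'b) \<Rightarrow> 'b uprod multiset" where
  "state_image G \<sigma> = image_mset (map_uprod \<sigma>) (edges G)"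

definition nonisolated :: "'a multigraph \<Rightarrow> 'a set" where
  "nonisolated G = (\<Union>e \<in> set_mset (edges G). set_uprod e)"

text \<open>Multiplicities become exponents, which embeds multisets of pairs injectively into the
  monomials.\<close>

definition edge_monomial :: "nat uprod multiset \<Rightarrow> nat uprod \<Rightarrow>\<^sub>0 nat" where
  "edge_monomial M = (\<Sum>e\<in>#M. Poly_Mapping.single e 1)"

lemma lookup_edge_monomial: "Poly_Mapping.lookup (edge_monomial M) e = count M e"
  by (induction M) (auto simp: edge_monomial_def lookup_add lookup_single when_def)

lemma edge_monomial_eq_iff [simp]: "edge_monomial M = edge_monomial N \<longleftrightarrow> M = N"
  by (metis lookup_edge_monomial multiset_eqI)

lemma edge_weight_eq: "edge_weight \<sigma> e = Poly_Mapping.single (Poly_Mapping.single (map_uprod \<sigma> e) 1) 1"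
  by (cases e) (simp add: W_def)

lemma prod_edge_weight:
  "(\<Prod>e \<in># edges G. edge_weight \<sigma> e) = Poly_Mapping.single (edge_monomial (state_image G \<sigma>)) 1"
proof -
  have "(\<Prod>e \<in># M. edge_weight \<sigma> e)
      = Poly_Mapping.single (edge_monomial (image_mset (map_uprod \<sigma>) M)) 1" for M
    by (induction M) (simp_all add: edge_monomial_def edge_weight_eq mult_single)
  then show ?thesis by (simp add: state_image_def)
qed

lemma finite_states: "finite_graph G \<Longrightarrow> finite (verts G \<rightarrow>\<^sub>E {1..n::nat})"
  by (simp add: finite_graph_def finite_PiE)

text \<open>Each state function contributes a single monomial with coefficient 1, and distinct
  images give distinct monomials, so a coefficient is the size of one fibre of
  \<open>state_image G\<close>.\<close>

lemma lookup_Z: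
  assumes "finite_graph G"
  shows "Poly_Mapping.lookup (Z n G) (edge_monomial M)
    = int (card {\<sigma> \<in> verts G \<rightarrow>\<^sub>E {1..n}. state_image G \<sigma> = M})"
proof -
  have "Poly_Mapping.lookup (Z n G) (edge_monomial M)
      = (\<Sum>\<sigma> \<in> verts G \<rightarrow>\<^sub>E {1..n}. if state_image G \<sigma> = M then 1 else 0)"
    by (simp add: Z_def prod_edge_weight lookup_sum lookup_single when_def eq_commute[of M])
  also have "\<dots> = int (card {\<sigma> \<in> verts G \<rightarrow>\<^sub>E {1..n}. state_image G \<sigma> = M})"
    using finite_states[OF assms] by (simp add: sum.If_cases Int_def)
  finally show ?thesis .
qed

lemma Z_eq_imp_card_states_eq:
  assumes "finite_graph G" and "finite_graph H" and "Z n G = Z n H"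
  shows "card {\<sigma> \<in> verts G \<rightarrow>\<^sub>E {1..n}. state_image G \<sigma> = M}
    = card {\<sigma> \<in> verts H \<rightarrow>\<^sub>E {1..n}. state_image H \<sigma> = M}"
  using assms lookup_Z[of G n M] lookup_Z[of H n M] by simp

text \<open>Coefficients are counts, so nothing cancels: the monomial of \<sigma> has a positive
  coefficient in \<open>Z n G\<close>, hence also in \<open>Z n H\<close>.\<close>

lemma Z_eq_imp_state:
  assumes "finite_graph G" and "finite_graph H" and "Z n G = Z n H"
    and "\<sigma> \<in> verts G \<rightarrow>\<^sub>E {1..n}"
  obtains \<tau> where "\<tau> \<in> verts H \<rightarrow>\<^sub>E {1..n}" and "state_image H \<tau> = state_image G \<sigma>"
proof -
  let ?S = "{\<rho> \<in> verts G \<rightarrow>\<^sub>E {1..n}. state_image G \<rho> = state_image G \<sigma>}"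
  have "finite ?S" "\<sigma> \<in> ?S"
    using finite_states[OF assms(1)] assms(4) by simp_all
  then have "card ?S \<noteq> 0" by auto
  then have "{\<tau> \<in> verts H \<rightarrow>\<^sub>E {1..n}. state_image H \<tau> = state_image G \<sigma>} \<noteq> {}"
    unfolding Z_eq_imp_card_states_eq[OF assms(1-3)] by (metis card.empty)
  then show thesis using that by blast
qed

lemma Z_eq_imp_state_images_eq:
  assumes "finite_graph G" and "finite_graph H" and "Z n G = Z n H"
  shows "state_image G ` (verts G \<rightarrow>\<^sub>E {1..n}) = state_image H ` (verts H \<rightarrow>\<^sub>E {1..n})"
proof (intro equalityI subsetI; elim imageE)
  fix M \<sigma> assume "M = state_image G \<sigma>" "\<sigma> \<in> verts G \<rightarrow>\<^sub>E {1..n}"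
  then show "M \<in> state_image H ` (verts H \<rightarrow>\<^sub>E {1..n})"
    using Z_eq_imp_state[OF assms] by (metis imageI)
next
  fix M \<sigma> assume "M = state_image H \<sigma>" "\<sigma> \<in> verts H \<rightarrow>\<^sub>E {1..n}"
  then show "M \<in> state_image G ` (verts G \<rightarrow>\<^sub>E {1..n})"
    using Z_eq_imp_state[OF assms(2,1) assms(3)[symmetric]] by (metis imageI)
qed

text \<open>Both sets of state functions split into fibres over the same images, with equal fibre
  sizes. Two states suffice, since a power of 2 determines its exponent; with one state the total
  would always be 1.\<close>

lemma Z_eq_imp_card_verts_eq:
  assumes G: "finite_graph G" and H: "finite_graph H" and eq: "Z 2 G = Z 2 H"
  shows "card (verts G) = card (verts H)"
proof -
  let ?S = "verts G \<rightarrow>\<^sub>E {1..2::nat}" and ?T = "verts H \<rightarrow>\<^sub>E {1..2::nat}"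
  have "card ?S = (\<Sum>M \<in> state_image G ` ?S. card {\<sigma> \<in> ?S. state_image G \<sigma> = M})"
    unfolding card_eq_sum by (rule sum.image_gen) (rule finite_states[OF G])
  also have "\<dots> = (\<Sum>M \<in> state_image H ` ?T. card {\<sigma> \<in> ?T. state_image H \<sigma> = M})"
    by (simp only: Z_eq_imp_state_images_eq[OF assms] Z_eq_imp_card_states_eq[OF assms])
  also have "\<dots> = card ?T"
    unfolding card_eq_sum by (rule sum.image_gen[symmetric]) (rule finite_states[OF H])
  finally show ?thesis
    using G H by (simp add: finite_graph_def card_PiE)
qed

text \<open>No edge meets an isolated vertex. This allows restricting maps to \<open>verts G\<close>
  and choosing values on isolated vertices freely.\<close>

lemma state_image_cong:
  assumes "\<And>v. v \<in> nonisolated G \<Longrightarrow> \<sigma> v = \<tau> v"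
  shows "state_image G \<sigma> = state_image G \<tau>"
  unfolding state_image_def
  by (rule image_mset_cong, rule uprod.map_cong) (use assms in \<open>auto simp: nonisolated_def\<close>)

lemma nonisolated_subset: "finite_graph G \<Longrightarrow> nonisolated G \<subseteq> verts G"
  by (auto simp: finite_graph_def nonisolated_def)

lemma state_image_id:
  assumes "\<And>v. v \<in> nonisolated G \<Longrightarrow> f v = v"
  shows "state_image G f = edges G"
  using state_image_cong[of G f id] assms by (simp add: state_image_def uprod.map_id0)

lemma state_image_comp: "state_image G (g \<circ> f) = image_mset (map_uprod g) (state_image G f)"
  by (simp add: state_image_def uprod.map_comp multiset.map_comp comp_def)

text \<open>Endpoints of a mapped edge are the images of its endpoints. The resulting surjectivity
  drives the later comparison of cardinalities.\<close>

lemma nonisolated_image: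
  assumes "state_image H \<tau> = edges G"
  shows "\<tau> ` nonisolated H = nonisolated G"
  unfolding nonisolated_def assms[symmetric] by (auto simp: state_image_def uprod.set_map)

text \<open>Replaces the pairwise multiplicity condition by one equation of multisets, which
  composes well with other maps.\<close>

lemma graph_isomorphic_iff:
  assumes G: "finite_graph G" and H: "finite_graph H"
  shows "graph_isomorphic G H \<longleftrightarrow> (\<exists>f. bij_betw f (verts G) (verts H) \<and> state_image G f = edges H)"
proof -
  have "(\<forall>u\<in>verts G. \<forall>v\<in>verts G. count (edges G) (Upair u v) = count (edges H) (Upair (f u) (f v)))
      \<longleftrightarrow> state_image G f = edges H" if f: "bij_betw f (verts G) (verts H)" for f
  proof -
    have cnt: "count (state_image G f) (Upair (f u) (f v)) = count (edges G) (Upair u v)"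
      if uv: "u \<in> verts G" "v \<in> verts G" for u v
    proof -
      have inj: "inj_on f (verts G)" using f by (rule bij_betw_imp_inj_on)
      have "map_uprod f e = Upair (f u) (f v) \<longleftrightarrow> e = Upair u v" if "e \<in># edges G" for e
      proof (cases e)
        case (Upair a b)
        then have "a \<in> verts G" "b \<in> verts G" using G that by (auto simp: finite_graph_def)
        then show ?thesis using Upair uv inj by (auto dest: inj_onD)
      qed
      \<comment> \<open>The multiplicity of a pair in the image is a sum over its fibre; injectivity
        of \<open>f\<close> leaves at most one edge there.\<close>
      then have "{e. e \<in># edges G \<and> Upair (f u) (f v) = map_uprod f e}
          = (if Upair u v \<in># edges G then {Upair u v} else {})"
        by (simp only: set_eq_iff mem_Collect_eq split: if_split) (metis empty_iff singleton_iff)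
      then show ?thesis
        by (simp add: state_image_def count_image_mset' not_in_iff)
    qed
    show ?thesis
    proof
      assume *: "\<forall>u\<in>verts G. \<forall>v\<in>verts G.
        count (edges G) (Upair u v) = count (edges H) (Upair (f u) (f v))"
      show "state_image G f = edges H"
      proof (rule multiset_eqI)
        fix e :: "'b uprod"
        show "count (state_image G f) e = count (edges H) e"
        proof (cases "set_uprod e \<subseteq> verts H")
          case True
          obtain a b where e: "e = Upair a b" by (cases e)
          with True have "a \<in> f ` verts G" "b \<in> f ` verts G"
            using bij_betw_imp_surj_on[OF f] by auto
          then show ?thesis using e cnt * by auto
        next
          \<comment> \<open>A pair that leaves \<open>verts H\<close> has multiplicity 0 on both
            sides.\<close>
          case False
          then have "e \<notin># edges H" using H by (auto simp: finite_graph_def)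
          moreover have "e \<notin># state_image G f"
            using False G bij_betw_imp_surj_on[OF f]
            by (fastforce simp: finite_graph_def state_image_def uprod.set_map)
          ultimately show ?thesis by (simp add: not_in_iff)
        qed
      qed
    next
      assume "state_image G f = edges H"
      then show "\<forall>u\<in>verts G. \<forall>v\<in>verts G.
        count (edges G) (Upair u v) = count (edges H) (Upair (f u) (f v))"
        using cnt by simp
    qed
  qed
  then show ?thesis unfolding graph_isomorphic_def by blast
qed

lemma Z_eq_if_isomorphic:
  assumes G: "finite_graph G" and H: "finite_graph H" and iso: "graph_isomorphic G H"
  shows "Z n G = Z n H"
proof -
  obtain f where f: "bij_betw f (verts G) (verts H)" and edges: "state_image G f = edges H"
    using iso graph_isomorphic_iff[OF G H] by blast
  let ?g = "inv_into (verts G) f"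
  have g: "bij_betw ?g (verts H) (verts G)" using f by (rule bij_betw_inv_into)
  have fv: "f v \<in> verts H" "?g (f v) = v" if "v \<in> verts G" for v
    using f that by (auto simp: bij_betw_def)
  have gw: "?g w \<in> verts G" "f (?g w) = w" if "w \<in> verts H" for w
    using f g that by (auto simp: bij_betw_def f_inv_into_f)
  have "(\<Sum>\<sigma> \<in> verts H \<rightarrow>\<^sub>E {1..n}. Poly_Mapping.single (edge_monomial (state_image H \<sigma>)) (1::int))
    = (\<Sum>\<sigma> \<in> verts G \<rightarrow>\<^sub>E {1..n}. Poly_Mapping.single (edge_monomial (state_image G \<sigma>)) 1)"
  \<comment> \<open>Composition with \<open>f\<close> and with its inverse matches the state
    functions; \<open>restrict\<close> makes the composites extensional again.\<close>
  proof (rule sum.reindex_bij_witness[where i = "\<lambda>\<sigma>. restrict (\<sigma> \<circ> ?g) (verts H)"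
        and j = "\<lambda>\<sigma>. restrict (\<sigma> \<circ> f) (verts G)"])
    fix \<sigma> assume "\<sigma> \<in> verts H \<rightarrow>\<^sub>E {1..n}"
    have "state_image G (restrict (\<sigma> \<circ> f) (verts G)) = state_image G (\<sigma> \<circ> f)"
      using nonisolated_subset[OF G] by (intro state_image_cong) auto
    also have "\<dots> = state_image H \<sigma>"
      by (simp only: state_image_comp edges) (simp add: state_image_def)
    finally show "Poly_Mapping.single (edge_monomial (state_image G (restrict (\<sigma> \<circ> f) (verts G)))) (1::int)
      = Poly_Mapping.single (edge_monomial (state_image H \<sigma>)) 1" by simp
  qed (auto simp: fv gw PiE_iff extensional_def fun_eq_iff)
  then show ?thesis by (simp add: Z_def prod_edge_weight)
qed

lemma Z_eq_imp_edge_map: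
  assumes G: "finite_graph G" and H: "finite_graph H" and eq: "\<And>n. n \<ge> 1 \<Longrightarrow> Z n G = Z n H"
  obtains \<tau> where "state_image H \<tau> = edges G"
proof -
  \<comment> \<open>Enough states for an injective state function; \<open>Suc\<close> keeps the
    number at least 1 when \<open>verts G\<close> is empty.\<close>
  let ?n = "Suc (card (verts G))"
  have "finite (verts G)" using G by (simp add: finite_graph_def)
  then obtain \<sigma> :: "'a \<Rightarrow> nat" where \<sigma>: "inj_on \<sigma> (verts G)" "\<sigma> ` verts G \<subseteq> {1..?n}"
    using card_le_inj[of "verts G" "{1..?n}"] by auto
  let ?\<sigma> = "restrict \<sigma> (verts G)"
  have "?\<sigma> \<in> verts G \<rightarrow>\<^sub>E {1..?n}" using \<sigma>(2) by auto
  then obtain \<tau> where \<tau>: "state_image H \<tau> = state_image G ?\<sigma>"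
    using Z_eq_imp_state[OF G H eq] by (metis le_add1 plus_1_eq_Suc)
  \<comment> \<open>Undoing the injective state function on \<open>verts G\<close>, which contains
    all endpoints, turns the common image back into the edges of \<open>G\<close>.\<close>
  have "state_image H (inv_into (verts G) \<sigma> \<circ> \<tau>) = state_image G (inv_into (verts G) \<sigma> \<circ> ?\<sigma>)"
    by (simp only: state_image_comp \<tau>)
  also have "\<dots> = edges G"
    using nonisolated_subset[OF G] \<sigma>(1) by (intro state_image_id) auto
  finally show thesis by (rule that)
qed

lemma isomorphic_if_Z_eq:
  assumes G: "finite_graph G" and H: "finite_graph H" and eq: "\<And>n. n \<ge> 1 \<Longrightarrow> Z n G = Z n H"
  shows "graph_isomorphic G H"
proof -
  obtain \<tau> where "state_image H \<tau> = edges G"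
    using Z_eq_imp_edge_map[OF G H eq] by blast
  then have \<tau>: "\<tau> ` nonisolated H = nonisolated G" by (rule nonisolated_image)
  obtain \<rho> where edges: "state_image G \<rho> = edges H"
    using Z_eq_imp_edge_map[OF H G eq[symmetric]] by blast
  then have \<rho>: "\<rho> ` nonisolated G = nonisolated H" by (rule nonisolated_image)
  note sub = nonisolated_subset[OF G] nonisolated_subset[OF H]
  have fin: "finite (verts G)" "finite (verts H)" using G H by (simp_all add: finite_graph_def)
  then have fin': "finite (nonisolated G)" "finite (nonisolated H)"
    using sub finite_subset by blast+
  \<comment> \<open>Surjections in both directions between finite sets give both
    inequalities.\<close>
  have card: "card (nonisolated G) = card (nonisolated H)"
    using card_image_le[OF fin'(1), of \<rho>] card_image_le[OF fin'(2), of \<tau>] \<rho> \<tau> by simp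
  then have bij1: "bij_betw \<rho> (nonisolated G) (nonisolated H)"
    using \<rho> fin' by (simp add: bij_betw_def eq_card_imp_inj_on)
  have "card (verts G - nonisolated G) = card (verts H - nonisolated H)"
    using Z_eq_imp_card_verts_eq[OF G H eq] card sub fin' by (simp add: card_Diff_subset)
  then obtain h where bij2: "bij_betw h (verts G - nonisolated G) (verts H - nonisolated H)"
    using fin by (meson finite_Diff finite_same_card_bij)
  \<comment> \<open>Only \<rho> affects the image of the edges; \<open>h\<close> merely completes it
    to a bijection of all vertices.\<close>
  let ?f = "\<lambda>v. if v \<in> nonisolated G then \<rho> v else h v"
  have "bij_betw ?f (nonisolated G \<union> (verts G - nonisolated G))
      (nonisolated H \<union> (verts H - nonisolated H))"
  proof (rule bij_betw_combine)
    show "bij_betw ?f (nonisolated G) (nonisolated H)"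
      using bij1 by (simp cong: bij_betw_cong)
    show "bij_betw ?f (verts G - nonisolated G) (verts H - nonisolated H)"
      using bij2 by (subst bij_betw_cong[where g = h]) auto
  qed auto
  then have "bij_betw ?f (verts G) (verts H)" using sub by (simp add: Un_absorb1)
  moreover have "state_image G ?f = edges H"
    using state_image_cong[of G ?f \<rho>] edges by simp
  ultimately show ?thesis unfolding graph_isomorphic_iff[OF G H] by (intro exI[of _ ?f] conjI)
qed

theorem theorem1p1:
  fixes G :: "'a multigraph" and H :: "'b multigraph"
  assumes "finite_graph G" and "finite_graph H"
  shows "(\<forall>n::nat. n \<ge> 1 \<longrightarrow> Z n G = Z n H) \<longleftrightarrow> graph_isomorphic G H"
  using Z_eq_if_isomorphic[OF assms] isomorphic_if_Z_eq[OF assms] by blast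

end
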